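(* Let $M\ge 1$, let $Q(x)$ be a real polynomial of degree $M$ with $M$ real zeros of multiplicity $1$, and let $p\in\mathbb{R}$ with $Q(p)\neq 0$. Let $(f_n)_{n\le M-2}$ and $(\psi_n)_{n\le M-2}$ be the families of functions defined in the context, and let $T=(T_{l,n})$ be the transition matrix from $\{f_n\}$ to $\{\psi_n\}$, i.e. $\psi_n(x)=\sum_l T_{l,n}(x-p)^l$, with rows and columns enumerated by the integers $n\le M-2$ in decreasing order. Then $T$ is an invertible upper triangular $\infty\times\infty$ matrix, and its left top $M\times M$ block is the unit matrix. More precisely, the matrix elements are $$T_{l,n}=\begin{cases}\delta_{l,n} & \text{for } n=M-2,\dots,0,-1,\\ 0 & \text{for } l<n \text{ or } l>n+M \ \ (n<-1),\\ (l+n+2)\,b_{l-n} & \text{for } n\le l\le n+M,\ n<-1.\end{cases}$$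
   Context: $\delta_{l,n}$ is the Kronecker delta. The real numbers $b_j=b_j(p)$ are defined by $Q(x)=\sum_{j=0}^M b_j(x-p)^j$. Let $V$ be the real vector space spanned by the functions $f_n(x)=(x-p)^n$ for all integers $n$ with $-\infty<n<M-1$. The functions $\psi_n\in V$ are defined by $$\psi_n(x)=\begin{cases}(x-p)^n & \text{for } -1\le n<M-1,\\ \sum_{l=n}^{n+M}(l+n+2)\,b_{l-n}\,(x-p)^l & \text{for } n<-1.\end{cases}$$ *)

theory Defs
  imports "HOL-Computational_Algebra.Polynomial"
begin

section \<open>Infinite matrices\<close>

text \<open>
  An infinite matrix is a function of its row and column number, both counted from 0.
  Products are formed within the algebra of column-finite matrices (the matrices of the
  endomorphisms of a vector space with a countable basis), so all sums are finite.
\<close>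

type_synonym inf_mat = "nat \<Rightarrow> nat \<Rightarrow> real"

definition column_finite :: "inf_mat \<Rightarrow> bool" where
  "column_finite A \<longleftrightarrow> (\<forall>j. finite {i. A i j \<noteq> 0})"

definition inf_mat_one :: inf_mat where
  "inf_mat_one = (\<lambda>i j. if i = j then 1 else 0)"

definition inf_mat_mult :: "inf_mat \<Rightarrow> inf_mat \<Rightarrow> inf_mat" where
  "inf_mat_mult A B = (\<lambda>i j. \<Sum>k | B k j \<noteq> 0. A i k * B k j)"

definition inf_mat_invertible :: "inf_mat \<Rightarrow> bool" where
  "inf_mat_invertible A \<longleftrightarrow> column_finite A \<and>
     (\<exists>B. column_finite B \<and> inf_mat_mult A B = inf_mat_one \<and> inf_mat_mult B A = inf_mat_one)"

definition inf_mat_upper_triangular :: "inf_mat \<Rightarrow> bool" where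
  "inf_mat_upper_triangular A \<longleftrightarrow> (\<forall>i j. j < i \<longrightarrow> A i j = 0)"

section \<open>Families of functions indexed by a set of integers\<close>

text \<open>
  \<open>T\<close> expresses every \<open>g n\<close> as a finite linear combination of the \<open>f l\<close>, as functions on \<open>D\<close>.
  The entries of \<open>T\<close> outside \<open>I \<times> I\<close> are irrelevant.
\<close>

definition is_transition_matrix ::
  "'x set \<Rightarrow> int set \<Rightarrow> (int \<Rightarrow> 'x \<Rightarrow> real) \<Rightarrow> (int \<Rightarrow> 'x \<Rightarrow> real) \<Rightarrow> (int \<Rightarrow> int \<Rightarrow> real) \<Rightarrow> bool"
  where
  "is_transition_matrix D I f g T \<longleftrightarrow>
     (\<forall>n\<in>I. finite {l\<in>I. T l n \<noteq> 0} \<and>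
        (\<forall>x\<in>D. g n x = (\<Sum>l | l \<in> I \<and> T l n \<noteq> 0. T l n * f l x)))"

text \<open>Row and column \<open>i\<close> of the infinite matrix belong to the index \<open>N - i\<close>.\<close>

definition decreasing_enum :: "int \<Rightarrow> (int \<Rightarrow> int \<Rightarrow> real) \<Rightarrow> inf_mat" where
  "decreasing_enum N T = (\<lambda>i j. T (N - int i) (N - int j))"

section \<open>The functions \<open>f\<^sub>n\<close> and \<open>\<psi>\<^sub>n\<close>\<close>

text \<open>For negative exponents only the values at points \<open>x \<noteq> p\<close> are meaningful.\<close>

definition f_fun :: "real \<Rightarrow> int \<Rightarrow> real \<Rightarrow> real" where
  "f_fun p n x = (x - p) powi n"

text \<open>The intended range of \<open>n\<close> is \<open>n \<le> M - 2\<close>.\<close>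

definition psi_fun :: "nat \<Rightarrow> (nat \<Rightarrow> real) \<Rightarrow> real \<Rightarrow> int \<Rightarrow> real \<Rightarrow> real" where
  "psi_fun M b p n x =
     (if - 1 \<le> n then (x - p) powi n
      else (\<Sum>l = n..n + int M. of_int (l + n + 2) * b (nat (l - n)) * (x - p) powi l))"

end

theory Submission
  imports Defs
begin

text \<open>
  Two independent facts carry the proof. First, integer powers of \<open>x - p\<close> are linearly
  independent as functions on the punctured line (\<open>powi_linear_independent\<close>): a vanishing finite
  combination becomes, after multiplication by a high power of \<open>x - p\<close>, a polynomial with
  infinitely many zeros. Hence the functions \<open>\<psi>\<^sub>n\<close> have at most one transition matrix
  (\<open>is_transition_matrix_unique\<close>), and its entries are those read off from the definition of
  \<open>\<psi>\<^sub>n\<close> (\<open>psi_matrix_is_transition_matrix\<close>).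

  Second, an infinite upper triangular matrix whose diagonal entries are all nonzero is invertible
  (\<open>upper_triangular_invertible\<close>), because each column of the inverse is found by finite back
  substitution. Triangularity is the fact that \<open>\<psi>\<^sub>n\<close> involves no power below \<open>(x - p)\<^sup>n\<close>. The
  diagonal entries are \<open>1\<close> for \<open>n \<ge> -1\<close> and \<open>2 (n + 1) b\<^sub>0\<close> for \<open>n < -1\<close>, with
  \<open>b\<^sub>0 = Q(p) \<noteq> 0\<close>. The factor \<open>n + 1\<close> vanishes only at \<open>n = -1\<close>, where
  \<open>\<psi>\<^sub>n\<close> is a plain power instead.
\<close>

section \<open>Inverting infinite upper triangular matrices\<close>

lemma inf_mat_mult_upper_triangular:
  assumes "inf_mat_upper_triangular B"
  shows "inf_mat_mult A B i j = (\<Sum>k\<le>j. A i k * B k j)"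
proof -
  have "{k. B k j \<noteq> 0} \<subseteq> {..j}"
    using assms by (auto simp: inf_mat_upper_triangular_def not_less[symmetric])
  then show ?thesis
    unfolding inf_mat_mult_def by (intro sum.mono_neutral_left) auto
qed

lemma upper_triangular_column_finite:
  assumes "inf_mat_upper_triangular A"
  shows "column_finite A"
  unfolding column_finite_def
proof
  fix j
  have "{i. A i j \<noteq> 0} \<subseteq> {..j}"
    using assms by (auto simp: inf_mat_upper_triangular_def not_less[symmetric])
  then show "finite {i. A i j \<noteq> 0}"
    by (rule finite_subset) simp
qed

lemma upper_triangular_one: "inf_mat_upper_triangular inf_mat_one"
  by (simp add: inf_mat_upper_triangular_def inf_mat_one_def)

lemma inf_mat_mult_one_right: "inf_mat_mult A inf_mat_one = A"
proof (intro ext)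
  fix i j
  have "inf_mat_mult A inf_mat_one i j = (\<Sum>k\<le>j. if k = j then A i k else 0)"
    unfolding inf_mat_mult_upper_triangular[OF upper_triangular_one]
    by (intro sum.cong) (auto simp: inf_mat_one_def)
  then show "inf_mat_mult A inf_mat_one i j = A i j"
    by simp
qed

lemma inf_mat_mult_one_left:
  assumes "inf_mat_upper_triangular A"
  shows "inf_mat_mult inf_mat_one A = A"
proof (intro ext)
  fix i j
  have "inf_mat_mult inf_mat_one A i j = (\<Sum>k\<le>j. if k = i then A k j else 0)"
    unfolding inf_mat_mult_upper_triangular[OF assms]
    by (intro sum.cong) (auto simp: inf_mat_one_def)
  then show "inf_mat_mult inf_mat_one A i j = A i j"
    using assms by (auto simp: inf_mat_upper_triangular_def)
qed

lemma upper_triangular_mult: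
  assumes "inf_mat_upper_triangular A" and B: "inf_mat_upper_triangular B"
  shows "inf_mat_upper_triangular (inf_mat_mult A B)"
  using assms(1)
  by (auto simp: inf_mat_upper_triangular_def inf_mat_mult_upper_triangular[OF B]
      intro!: sum.neutral)

lemma inf_mat_mult_assoc:
  assumes B: "inf_mat_upper_triangular B" and C: "inf_mat_upper_triangular C"
  shows "inf_mat_mult (inf_mat_mult A B) C = inf_mat_mult A (inf_mat_mult B C)"
proof (intro ext)
  fix i j
  have "inf_mat_mult (inf_mat_mult A B) C i j
      = (\<Sum>k\<le>j. (\<Sum>m\<le>k. A i m * B m k) * C k j)"
    by (simp add: inf_mat_mult_upper_triangular B C)
  \<comment> \<open>Extending the inner sums to a common range allows the interchange; the added terms vanish
    since \<open>B\<close> is upper triangular.\<close>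
  also have "\<dots> = (\<Sum>k\<le>j. (\<Sum>m\<le>j. A i m * B m k) * C k j)"
  proof (intro sum.cong refl)
    fix k assume "k \<in> {..j}"
    then have "(\<Sum>m\<le>k. A i m * B m k) = (\<Sum>m\<le>j. A i m * B m k)"
      using B by (intro sum.mono_neutral_left) (auto simp: inf_mat_upper_triangular_def)
    then show "(\<Sum>m\<le>k. A i m * B m k) * C k j = (\<Sum>m\<le>j. A i m * B m k) * C k j"
      by simp
  qed
  also have "\<dots> = (\<Sum>k\<le>j. \<Sum>m\<le>j. A i m * (B m k * C k j))"
    by (simp add: sum_distrib_right mult.assoc)
  also have "\<dots> = (\<Sum>m\<le>j. A i m * (\<Sum>k\<le>j. B m k * C k j))"
    by (subst sum.swap) (simp add: sum_distrib_left)
  also have "\<dots> = inf_mat_mult A (inf_mat_mult B C) i j"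
    by (simp add: inf_mat_mult_upper_triangular upper_triangular_mult B C)
  finally show "inf_mat_mult (inf_mat_mult A B) C i j = inf_mat_mult A (inf_mat_mult B C) i j" .
qed

text \<open>
  Back substitution: the last unknown is \<open>w n / A n n\<close>, and subtracting its contribution leaves
  a right-hand side with support one shorter.
\<close>

lemma upper_triangular_solve:
  assumes "inf_mat_upper_triangular A" and "\<And>i. A i i \<noteq> 0"
    and "\<And>i. i \<ge> n \<Longrightarrow> w i = 0"
  shows "\<exists>v. (\<forall>i\<ge>n. v i = 0) \<and> (\<forall>i. (\<Sum>k<n. A i k * v k) = w i)"
  using assms(3)
proof (induction n arbitrary: w)
  case 0
  then show ?case by (intro exI[of _ "\<lambda>_. 0"]) simp
next
  case (Suc n)
  define c where "c = w n / A n n"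
  have "w i - A i n * c = 0" if "i \<ge> n" for i
  proof (cases "i = n")
    case True
    then show ?thesis using assms(2) by (simp add: c_def)
  next
    case False
    then show ?thesis
      using that assms(1) Suc.prems by (simp add: inf_mat_upper_triangular_def)
  qed
  from Suc.IH[of "\<lambda>i. w i - A i n * c", OF this]
  obtain v where v: "\<forall>i\<ge>n. v i = 0" "\<And>i. (\<Sum>k<n. A i k * v k) = w i - A i n * c"
    by blast
  have "(\<Sum>k<Suc n. A i k * (v(n := c)) k) = w i" for i
  proof -
    have "(\<Sum>k<n. A i k * (v(n := c)) k) = (\<Sum>k<n. A i k * v k)"
      by (intro sum.cong) auto
    then show ?thesis by (simp add: v(2))
  qed
  moreover have "\<forall>i\<ge>Suc n. (v(n := c)) i = 0"
    using v(1) by auto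
  ultimately show ?case by blast
qed

lemma upper_triangular_right_inverse:
  assumes "inf_mat_upper_triangular A" and "\<And>i. A i i \<noteq> 0"
  obtains B where "inf_mat_upper_triangular B" and "\<And>i. B i i \<noteq> 0"
    and "inf_mat_mult A B = inf_mat_one"
proof -
  have "\<exists>v. (\<forall>i\<ge>Suc j. v i = 0) \<and> (\<forall>i. (\<Sum>k<Suc j. A i k * v k) = inf_mat_one i j)" for j
    using assms by (rule upper_triangular_solve) (simp_all add: inf_mat_one_def)
  then obtain v where v: "\<And>j i. i \<ge> Suc j \<Longrightarrow> v j i = 0"
    "\<And>j i. (\<Sum>k<Suc j. A i k * v j k) = inf_mat_one i j"
    by metis
  define B where "B = (\<lambda>i j. v j i)"
  have upper: "inf_mat_upper_triangular B"
    using v(1) by (simp add: inf_mat_upper_triangular_def B_def)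
  have inverse: "inf_mat_mult A B = inf_mat_one"
    using v(2)
    by (intro ext)
      (simp add: inf_mat_mult_upper_triangular[OF upper] lessThan_Suc_atMost,
        simp add: B_def)
  have "B j j \<noteq> 0" for j
  proof
    assume "B j j = 0"
    \<comment> \<open>The diagonal of a product of upper triangular matrices is the product of the diagonals.\<close>
    then have "A j k * B k j = 0" if "k \<le> j" for k
      using that assms(1) by (cases "k = j") (auto simp: inf_mat_upper_triangular_def)
    then have "inf_mat_mult A B j j = 0"
      unfolding inf_mat_mult_upper_triangular[OF upper] by (intro sum.neutral) simp
    then show False by (simp add: inverse inf_mat_one_def)
  qed
  with upper inverse that show thesis by blast
qed

text \<open>
  The right inverse \<open>B\<close> of \<open>A\<close> has a right inverse \<open>C\<close> for the same reason that \<open>A\<close> has one,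
  and then \<open>A = A (B C) = (A B) C = C\<close>.
\<close>

lemma upper_triangular_invertible:
  assumes A: "inf_mat_upper_triangular A" and "\<And>i. A i i \<noteq> 0"
  shows "inf_mat_invertible A"
proof -
  obtain B where B: "inf_mat_upper_triangular B" "\<And>i. B i i \<noteq> 0"
    and AB: "inf_mat_mult A B = inf_mat_one"
    using upper_triangular_right_inverse assms by blast
  obtain C where C: "inf_mat_upper_triangular C" and BC: "inf_mat_mult B C = inf_mat_one"
    using upper_triangular_right_inverse B by blast
  have "A = inf_mat_mult A (inf_mat_mult B C)"
    by (simp add: BC inf_mat_mult_one_right)
  also have "\<dots> = inf_mat_mult (inf_mat_mult A B) C"
    by (simp add: inf_mat_mult_assoc B C)
  also have "\<dots> = C"
    by (simp add: AB inf_mat_mult_one_left C)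
  finally have "inf_mat_mult B A = inf_mat_one"
    using BC by simp
  with A B(1) AB show ?thesis
    unfolding inf_mat_invertible_def by (blast intro: upper_triangular_column_finite)
qed

section \<open>Uniqueness of the transition matrix\<close>

lemma powi_linear_independent:
  fixes c :: "int \<Rightarrow> real"
  assumes "finite S" and vanish: "\<And>x. x \<noteq> p \<Longrightarrow> (\<Sum>l\<in>S. c l * (x - p) powi l) = 0"
    and "l \<in> S"
  shows "c l = 0"
proof -
  obtain K where K: "\<And>l. l \<in> S \<Longrightarrow> - int K \<le> l"
  proof -
    have "- int (nat (- Min S)) \<le> l" if "l \<in> S" for l
      using Min_le[OF \<open>finite S\<close> that] by linarith
    then show thesis by (rule that)
  qed
  define P where "P = (\<Sum>l\<in>S. monom (c l) (nat (l + int K)))"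
  have "poly P y = 0" if "y \<noteq> 0" for y
  proof -
    have "y ^ nat (l + int K) = y powi l * y ^ K" if "l \<in> S" for l
    proof -
      have "y ^ nat (l + int K) = y powi (l + int K)"
        using K[OF that] by (simp add: power_int_def)
      then show ?thesis using \<open>y \<noteq> 0\<close> by (simp add: power_int_add)
    qed
    then have "poly P y = (\<Sum>l\<in>S. c l * y powi l) * y ^ K"
      by (simp add: P_def poly_sum poly_monom sum_distrib_right mult.assoc)
    then show ?thesis using vanish[of "y + p"] that by simp
  qed
  then have "- {0} \<subseteq> {y. poly P y = 0}" by auto
  moreover have "infinite (- {0 :: real})"
    by (simp add: infinite_UNIV_char_0)
  ultimately have "P = 0"
    using poly_roots_finite finite_subset by blast
  moreover have "coeff P (nat (l + int K)) = c l"
  proof -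
    have "coeff P (nat (l + int K)) = (\<Sum>m\<in>S. if m = l then c m else 0)"
      unfolding P_def coeff_sum
    proof (intro sum.cong refl)
      fix m assume "m \<in> S"
      then show "coeff (monom (c m) (nat (m + int K))) (nat (l + int K)) = (if m = l then c m else 0)"
        using K[of m] K[OF \<open>l \<in> S\<close>] by auto
    qed
    then show ?thesis using assms(1,3) by simp
  qed
  ultimately show ?thesis by simp
qed

lemma is_transition_matrix_unique:
  assumes T: "is_transition_matrix (- {p}) I (f_fun p) g T"
    and T': "is_transition_matrix (- {p}) I (f_fun p) g T'"
    and "l \<in> I" "n \<in> I"
  shows "T l n = T' l n"
proof (cases "T l n = 0 \<and> T' l n = 0")
  case False
  define S where "S = {l\<in>I. T l n \<noteq> 0} \<union> {l\<in>I. T' l n \<noteq> 0}"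
  have "finite S"
    using T T' \<open>n \<in> I\<close> by (simp add: S_def is_transition_matrix_def)
  have expand: "g n x = (\<Sum>l\<in>S. U l n * f_fun p l x)"
    if "U = T \<or> U = T'" "x \<noteq> p" for U x
  proof -
    have "g n x = (\<Sum>l | l \<in> I \<and> U l n \<noteq> 0. U l n * f_fun p l x)"
      using T T' that \<open>n \<in> I\<close> by (auto simp: is_transition_matrix_def)
    also have "\<dots> = (\<Sum>l\<in>S. U l n * f_fun p l x)"
      using that(1) \<open>finite S\<close> by (intro sum.mono_neutral_left) (auto simp: S_def)
    finally show ?thesis .
  qed
  have "(\<Sum>l\<in>S. (T l n - T' l n) * (x - p) powi l) = 0" if "x \<noteq> p" for x
    using expand[of T x] expand[of T' x] that
    by (simp add: f_fun_def left_diff_distrib sum_subtractf)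
  from powi_linear_independent[OF \<open>finite S\<close> this] show ?thesis
    using False \<open>l \<in> I\<close> by (auto simp: S_def)
qed simp

section \<open>The transition matrix to the functions \<open>\<psi>\<^sub>n\<close>\<close>

definition psi_matrix :: "nat \<Rightarrow> (nat \<Rightarrow> real) \<Rightarrow> int \<Rightarrow> int \<Rightarrow> real" where
  "psi_matrix M b l n =
     (if - 1 \<le> n then if l = n then 1 else 0
      else if n \<le> l \<and> l \<le> n + int M then of_int (l + n + 2) * b (nat (l - n)) else 0)"

text \<open>
  The sum defining \<open>\<psi>\<^sub>n\<close> for \<open>n < -1\<close> stays within the index set, as
  \<open>n + M \<le> M - 2\<close>. Some of its coefficients may vanish (that at \<open>l = - n - 2\<close>, if this exponent is
  in the range of the sum), so the support of the column can be smaller than that range.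
\<close>

lemma psi_matrix_is_transition_matrix:
  "is_transition_matrix (- {p}) {..int M - 2} (f_fun p) (psi_fun M b p) (psi_matrix M b)"
  unfolding is_transition_matrix_def
proof (intro ballI conjI)
  fix n assume n: "n \<in> {..int M - 2}"
  define S where "S = (if - 1 \<le> n then {n} else {n..n + int M})"
  have "finite S" by (simp add: S_def)
  have support: "{l \<in> {..int M - 2}. psi_matrix M b l n \<noteq> 0} \<subseteq> S"
    by (auto simp: S_def psi_matrix_def split: if_splits)
  show "finite {l \<in> {..int M - 2}. psi_matrix M b l n \<noteq> 0}"
    using support \<open>finite S\<close> by (rule finite_subset)
  fix x
  have "psi_fun M b p n x = (\<Sum>l\<in>S. psi_matrix M b l n * f_fun p l x)"
    by (simp add: S_def psi_fun_def psi_matrix_def f_fun_def)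
  also have "\<dots> = (\<Sum>l | l \<in> {..int M - 2} \<and> psi_matrix M b l n \<noteq> 0. psi_matrix M b l n * f_fun p l x)"
    using support \<open>finite S\<close> n
    by (intro sum.mono_neutral_right) (auto simp: S_def split: if_splits)
  finally show "psi_fun M b p n x
      = (\<Sum>l | l \<in> {..int M - 2} \<and> psi_matrix M b l n \<noteq> 0. psi_matrix M b l n * f_fun p l x)" .
qed

lemma psi_matrix_diagonal_nonzero:
  assumes "b 0 \<noteq> 0"
  shows "psi_matrix M b n n \<noteq> 0"
proof (cases "- 1 \<le> n")
  case False
  then have "of_int (n + n + 2) \<noteq> (0 :: real)"
    by (subst of_int_eq_0_iff) linarith
  with False assms show ?thesis by (simp add: psi_matrix_def del: of_int_add)
qed (simp add: psi_matrix_def)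

theorem lemma4p1:
  fixes M :: nat and Q :: "real poly" and p :: real and b :: "nat \<Rightarrow> real"
  assumes "M \<ge> 1"
    and "degree Q = M"
    and "card {x. poly Q x = 0 \<and> order x Q = 1} = M"
    and "poly Q p \<noteq> 0"
    and "\<forall>x. poly Q x = (\<Sum>j = 0..M. b j * (x - p) ^ j)"
  shows "(\<exists>T. is_transition_matrix (- {p}) {..int M - 2} (f_fun p) (psi_fun M b p) T) \<and>
    (\<forall>T. is_transition_matrix (- {p}) {..int M - 2} (f_fun p) (psi_fun M b p) T \<longrightarrow>
       inf_mat_invertible (decreasing_enum (int M - 2) T) \<and>
       inf_mat_upper_triangular (decreasing_enum (int M - 2) T) \<and>
       (\<forall>i<M. \<forall>j<M. decreasing_enum (int M - 2) T i j = (if i = j then 1 else 0)) \<and>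
       (\<forall>l\<le>int M - 2. \<forall>n\<le>int M - 2.
          (- 1 \<le> n \<longrightarrow> T l n = (if l = n then 1 else 0)) \<and>
          (n < - 1 \<and> (l < n \<or> n + int M < l) \<longrightarrow> T l n = 0) \<and>
          (n < - 1 \<and> n \<le> l \<and> l \<le> n + int M \<longrightarrow>
             T l n = of_int (l + n + 2) * b (nat (l - n)))))"
proof (intro conjI allI impI)
  show "\<exists>T. is_transition_matrix (- {p}) {..int M - 2} (f_fun p) (psi_fun M b p) T"
    using psi_matrix_is_transition_matrix by blast
next
  fix T
  assume T: "is_transition_matrix (- {p}) {..int M - 2} (f_fun p) (psi_fun M b p) T"
  have entries: "T l n = psi_matrix M b l n" if "l \<le> int M - 2" "n \<le> int M - 2" for l n
    using is_transition_matrix_unique[OF T psi_matrix_is_transition_matrix] that by simp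
  have "poly Q p = (\<Sum>j = 0..M. if j = 0 then b j else 0)"
    using assms(5) by (auto intro!: sum.cong)
  then have b0: "b 0 \<noteq> 0"
    using assms(4) by simp
  show upper: "inf_mat_upper_triangular (decreasing_enum (int M - 2) T)"
    by (auto simp: inf_mat_upper_triangular_def decreasing_enum_def entries psi_matrix_def)
  show "inf_mat_invertible (decreasing_enum (int M - 2) T)"
    using upper
    by (rule upper_triangular_invertible)
      (simp add: decreasing_enum_def entries psi_matrix_diagonal_nonzero b0)
  show "decreasing_enum (int M - 2) T i j = (if i = j then 1 else 0)" if "i < M" "j < M" for i j
    using that by (simp add: decreasing_enum_def entries psi_matrix_def)
  fix l n :: int
  assume l: "l \<le> int M - 2" and n: "n \<le> int M - 2"
  show "T l n = (if l = n then 1 else 0)" if "- 1 \<le> n"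
    using that by (simp add: entries l n psi_matrix_def)
  show "T l n = 0" if "n < - 1 \<and> (l < n \<or> n + int M < l)"
    using that by (auto simp: entries l n psi_matrix_def)
  show "T l n = of_int (l + n + 2) * b (nat (l - n))" if "n < - 1 \<and> n \<le> l \<and> l \<le> n + int M"
    using that by (simp add: entries l n psi_matrix_def)
qed

end
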